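(* Let $R$ be a finite commutative von Neumann regular ring, and suppose $R\cong F_1\times F_2\times\cdots\times F_n$, where $F_1,\dots,F_n$ are fields. Let $a=(a_1,\dots,a_n)\neq(0,\dots,0)$ be a vertex of $\Gamma'_{Reg}(R)$ (identifying $R$ with the product), let $I=\{i : a_i=0_{F_i}\}=\{i_1,\dots,i_k\}$ be the set of indices of its zero coordinates, and $k=|I|$. If $k>0$, then $$\deg_{\Gamma'_{Reg}(R)}(a)=\begin{cases}2^{n-k}-3+|F_{i_1}||F_{i_2}|\cdots|F_{i_k}|, & \text{if } a_i^{-1}=a_i \text{ for every } i \text{ with } a_i\neq 0_{F_i},\\ 2^{n-k}-2+|F_{i_1}||F_{i_2}|\cdots|F_{i_k}|, & \text{otherwise.}\end{cases}$$ If $k=0$, then $$\deg_{\Gamma'_{Reg}(R)}(a)=\begin{cases}2^{n}-2, & \text{if } a_i^{-1}=a_i \text{ for every } i,\\ 2^{n}-1, & \text{otherwise.}\end{cases}$$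
   Context: All rings have an identity. A ring $R$ is von Neumann regular if for every $x\in R$ there is $y\in R$ with $xyx=x$. For such $R$, $\Gamma'_{Reg}(R)$ is the simple graph with vertex set $R\setminus\{0_R\}$ in which two distinct vertices $a,b$ are adjacent if and only if $aba=a$ or $bab=b$. *)

theory Defs
  imports "HOL-Algebra.Chinese_Remainder"
begin

record 'v simple_graph =
  vertices :: "'v set"
  edges :: "'v set set"

definition wf_simple_graph :: "'v simple_graph \<Rightarrow> bool" where
  "wf_simple_graph G \<longleftrightarrow> (\<forall>e \<in> edges G. e \<subseteq> vertices G \<and> card e = 2)"

definition adjacent :: "'v simple_graph \<Rightarrow> 'v \<Rightarrow> 'v \<Rightarrow> bool" where
  "adjacent G u v \<longleftrightarrow> {u, v} \<in> edges G"

definition vertex_degree :: "'v simple_graph \<Rightarrow> 'v \<Rightarrow> nat" where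
  "vertex_degree G v = card {w \<in> vertices G. adjacent G v w}"

locale von_neumann_regular_ring = ring R for R (structure) +
  assumes regular: "x \<in> carrier R \<Longrightarrow> \<exists>y \<in> carrier R. x \<otimes> y \<otimes> x = x"

definition reg_graph :: "('a, 'm) ring_scheme \<Rightarrow> 'a simple_graph" where
  "reg_graph R =
    \<lparr>vertices = carrier R - {\<zero>\<^bsub>R\<^esub>},
     edges = {{a, b} | a b. a \<in> carrier R - {\<zero>\<^bsub>R\<^esub>} \<and> b \<in> carrier R - {\<zero>\<^bsub>R\<^esub>} \<and> a \<noteq> b \<and>
       (a \<otimes>\<^bsub>R\<^esub> b \<otimes>\<^bsub>R\<^esub> a = a \<or> b \<otimes>\<^bsub>R\<^esub> a \<otimes>\<^bsub>R\<^esub> b = b)}\<rparr>"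

lemma wf_reg_graph: "wf_simple_graph (reg_graph R)"
  by (auto simp: wf_simple_graph_def reg_graph_def)

lemma adjacent_reg_graph_iff:
  assumes "a \<in> vertices (reg_graph R)" "b \<in> vertices (reg_graph R)"
  shows "adjacent (reg_graph R) a b \<longleftrightarrow>
    a \<noteq> b \<and> (a \<otimes>\<^bsub>R\<^esub> b \<otimes>\<^bsub>R\<^esub> a = a \<or> b \<otimes>\<^bsub>R\<^esub> a \<otimes>\<^bsub>R\<^esub> b = b)"
  using assms by (auto simp: adjacent_def reg_graph_def doubleton_eq_iff)

end

theory Submission
  imports Defs
begin

text \<open>
  In the product, both relations \<open>aba = a\<close> and \<open>bab = b\<close> are coordinatewise. Over a field,
  \<open>xyx = x\<close> allows every \<open>y\<close> if \<open>x = 0\<close> and only \<open>y = x\<^sup>-\<^sup>1\<close> otherwise, while \<open>yxy = y\<close> allows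
  only \<open>y = 0\<close> if \<open>x = 0\<close> and \<open>y \<in> {0, x\<^sup>-\<^sup>1}\<close> otherwise. Hence the solution sets of the two relations
  are boxes of sizes \<open>\<Prod>\<^bsub>i\<in>I\<^esub> |F\<^sub>i|\<close> and \<open>2\<^sup>n\<^sup>-\<^sup>k\<close> that share exactly one point. The degree is the size of
  their union without \<open>0\<close>, which always lies in it, and without \<open>a\<close>, which lies in it
  iff all nonzero coordinates of \<open>a\<close> are their own inverses.
\<close>

section \<open>Boxes of lists and their cardinality\<close>

definition list_box :: "nat \<Rightarrow> (nat \<Rightarrow> 'a set) \<Rightarrow> 'a list set" where
  "list_box n A = {xs. length xs = n \<and> (\<forall>i<n. xs ! i \<in> A i)}"

text \<open>Tabulating an extensional function over \<open>[0..<n]\<close> identifies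
  \<open>Pi\<^sub>E {..<n} A\<close> with the box. The inverse reads off the entries, restricted to
  indices below \<open>n\<close> so that the result is extensional again.\<close>

lemma card_list_box: "card (list_box n A) = (\<Prod>i<n. card (A i))"
proof -
  have "bij_betw (\<lambda>f. map f [0..<n]) (Pi\<^sub>E {..<n} A) (list_box n A)"
  proof (rule bij_betw_byWitness[where f' = "\<lambda>xs. restrict (\<lambda>i. xs ! i) {..<n}"])
    show "\<forall>f\<in>Pi\<^sub>E {..<n} A. restrict (\<lambda>i. map f [0..<n] ! i) {..<n} = f"
      by (auto simp: PiE_def extensional_def fun_eq_iff)
    show "\<forall>xs\<in>list_box n A. map (restrict (\<lambda>i. xs ! i) {..<n}) [0..<n] = xs"
      by (auto simp: list_box_def intro!: nth_equalityI)
    show "(\<lambda>f. map f [0..<n]) ` Pi\<^sub>E {..<n} A \<subseteq> list_box n A"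
      by (rule image_subsetI) (simp add: list_box_def PiE_iff)
    show "(\<lambda>xs. restrict (\<lambda>i. xs ! i) {..<n}) ` list_box n A \<subseteq> Pi\<^sub>E {..<n} A"
      by (rule image_subsetI) (simp add: list_box_def PiE_iff)
  qed
  then show ?thesis
    using bij_betw_same_card card_PiE[OF finite_lessThan, of n A] by metis
qed

lemma list_box_Int: "list_box n A \<inter> list_box n B = list_box n (\<lambda>i. A i \<inter> B i)"
  by (auto simp: list_box_def)

section \<open>Coordinates in the product ring\<close>

lemma carrier_RDirProd_list: "carrier (RDirProd_list Rs) = list_box (length Rs) (\<lambda>i. carrier (Rs ! i))"
  by (auto simp: list_box_def RDirProd_list_carrier_mem intro: RDirProd_list_carrier_memI)

text \<open>Consing is a ring homomorphism from the binary product of \<open>R\<close> and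
  \<open>RDirProd_list Rs\<close>, where multiplication is componentwise. This is what drives the
  induction giving products entry by entry.\<close>

lemma mult_RDirProd_list_Cons:
  assumes "x \<in> carrier R" "y \<in> carrier R"
    and "xs \<in> carrier (RDirProd_list Rs)" "ys \<in> carrier (RDirProd_list Rs)"
  shows "(x # xs) \<otimes>\<^bsub>RDirProd_list (R # Rs)\<^esub> (y # ys) =
    (x \<otimes>\<^bsub>R\<^esub> y) # (xs \<otimes>\<^bsub>RDirProd_list Rs\<^esub> ys)"
  using ring_hom_mult[OF RDirProd_list_hom1, of "(x, xs)" R Rs "(y, ys)"] assms
  by (simp add: RDirProd_carrier) (simp add: RDirProd_def DirProd_def monoid.defs)

lemma nth_mult_RDirProd_list:
  assumes "xs \<in> carrier (RDirProd_list Rs)" "us \<in> carrier (RDirProd_list Rs)" "i < length Rs"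
  shows "(xs \<otimes>\<^bsub>RDirProd_list Rs\<^esub> us) ! i = xs ! i \<otimes>\<^bsub>Rs ! i\<^esub> us ! i"
  using assms
proof (induction Rs arbitrary: xs us i)
  case Nil
  then show ?case by simp
next
  case (Cons R Rs)
  from Cons.prems(1,2) obtain y ys z zs where yz: "xs = y # ys" "us = z # zs"
    and carr: "y \<in> carrier R" "z \<in> carrier R"
      "ys \<in> carrier (RDirProd_list Rs)" "zs \<in> carrier (RDirProd_list Rs)"
    by (auto simp: RDirProd_list_carrier)
  show ?case
    unfolding yz mult_RDirProd_list_Cons[OF carr] using Cons.IH[OF carr(3,4)] Cons.prems(3)
    by (cases i) simp_all
qed

lemma RDirProd_list_eqI:
  assumes "xs \<in> carrier (RDirProd_list Rs)" "ys \<in> carrier (RDirProd_list Rs)"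
    and "\<And>i. i < length Rs \<Longrightarrow> xs ! i = ys ! i"
  shows "xs = ys"
  using assms by (metis RDirProd_list_carrier_mem(1) nth_equalityI)

text \<open>Products and equality of lists are both decided entrywise. Used with either order of the
  arguments, it turns both adjacency relations into membership in a box.\<close>

lemma RDirProd_list_inner_inverse_iff:
  assumes "\<And>i. i < length Rs \<Longrightarrow> ring (Rs ! i)"
    and "xs \<in> carrier (RDirProd_list Rs)" "ys \<in> carrier (RDirProd_list Rs)"
  shows "xs \<otimes>\<^bsub>RDirProd_list Rs\<^esub> ys \<otimes>\<^bsub>RDirProd_list Rs\<^esub> xs = xs \<longleftrightarrow>
    (\<forall>i<length Rs. xs ! i \<otimes>\<^bsub>Rs ! i\<^esub> ys ! i \<otimes>\<^bsub>Rs ! i\<^esub> xs ! i = xs ! i)"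
proof -
  interpret ring "RDirProd_list Rs"
    using assms(1) by (rule RDirProd_list_is_ring)
  have eq: "xs = zs \<longleftrightarrow> (\<forall>i<length Rs. xs ! i = zs ! i)"
    if "xs \<in> carrier (RDirProd_list Rs)" "zs \<in> carrier (RDirProd_list Rs)" for xs zs
    using that RDirProd_list_eqI by blast
  show ?thesis
    using assms by (subst eq) (auto simp: nth_mult_RDirProd_list)
qed

section \<open>The two relations over a single field\<close>

lemma (in field) inner_inverse_iff:
  assumes "x \<in> carrier R" "y \<in> carrier R"
  shows "x \<otimes> y \<otimes> x = x \<longleftrightarrow> x = \<zero> \<or> y = inv x"
proof (cases "x = \<zero>")
  case False
  then have x: "x \<in> Units R"
    using assms field_Units by simp
  have "x \<otimes> y \<otimes> x = x \<longleftrightarrow> x \<otimes> (y \<otimes> x) = x \<otimes> \<one>"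
    using assms by (simp add: m_assoc)
  also have "\<dots> \<longleftrightarrow> y \<otimes> x = \<one>"
    using assms False by (intro m_lcancel) auto
  \<comment> \<open>By commutativity a left inverse of \<open>x\<close> is already
    \<open>inv x\<close>.\<close>
  also have "\<dots> \<longleftrightarrow> y = inv x"
    using assms x by (metis Units_l_inv comm_inv_char m_comm)
  finally show ?thesis
    using False by simp
qed (use assms in auto)

lemma (in field) inv_nonzero:
  assumes "x \<in> carrier R" "x \<noteq> \<zero>"
  shows "inv x \<in> carrier R" "inv x \<noteq> \<zero>" "inv (inv x) = x"
proof -
  have "x \<in> Units R"
    using assms field_Units by simp
  then show "inv x \<in> carrier R" "inv x \<noteq> \<zero>" "inv (inv x) = x"
    using Units_inv_Units[of x] by (auto simp: field_Units)
qed

lemma (in field) inner_inverses_eq: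
  assumes "x \<in> carrier R"
  shows "{y \<in> carrier R. x \<otimes> y \<otimes> x = x} = (if x = \<zero> then carrier R else {inv x})"
  using assms inv_nonzero[of x] by (auto simp: inner_inverse_iff)

text \<open>This is the inner relation with the roles exchanged, so \<open>inner_inverse_iff\<close>
  gives \<open>y = \<zero>\<close> or \<open>x = inv y\<close>; it remains to solve the latter for
  \<open>y\<close>.\<close>

lemma (in field) outer_inverses_eq:
  assumes "x \<in> carrier R"
  shows "{y \<in> carrier R. y \<otimes> x \<otimes> y = y} = (if x = \<zero> then {\<zero>} else {\<zero>, inv x})"
proof -
  \<comment> \<open>Inversion is an involution on nonzero elements. For \<open>x = \<zero>\<close>
    there is no solution, since the inverse of a nonzero \<open>y\<close> is nonzero.\<close>
  have "x = inv y \<longleftrightarrow> x \<noteq> \<zero> \<and> y = inv x" if "y \<in> carrier R" "y \<noteq> \<zero>" for y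
    using that assms inv_nonzero by metis
  then show ?thesis
    using assms inv_nonzero[of x] by (auto simp: inner_inverse_iff)
qed

section \<open>Transport of degrees along a ring isomorphism\<close>

lemma ring_iso_nonzero:
  assumes "ring R" "ring S" and \<phi>: "\<phi> \<in> ring_iso R S" and a: "a \<in> carrier R - {\<zero>\<^bsub>R\<^esub>}"
  shows "\<phi> a \<in> carrier S - {\<zero>\<^bsub>S\<^esub>}"
proof -
  interpret ring_hom_ring R S \<phi>
    using assms by (intro ring_hom_ringI2) (auto simp: ring_iso_def)
  have "inj_on \<phi> (carrier R)"
    using ring_iso_memE(5)[OF \<phi>] by (rule bij_betw_imp_inj_on)
  then have "\<phi> a \<noteq> \<phi> \<zero>\<^bsub>R\<^esub>"
    using a by (metis DiffD1 DiffD2 R.zero_closed inj_onD singletonI)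
  then show ?thesis
    using a by simp
qed

text \<open>Being injective and multiplicative, \<open>\<phi>\<close> preserves and reflects zero,
  equality and both relations, so it maps the neighbours of \<open>a\<close> bijectively onto those
  of \<open>\<phi> a\<close>.\<close>

lemma vertex_degree_reg_graph_iso:
  assumes "ring R" "ring S" and \<phi>: "\<phi> \<in> ring_iso R S" and a: "a \<in> carrier R - {\<zero>\<^bsub>R\<^esub>}"
  shows "vertex_degree (reg_graph S) (\<phi> a) = vertex_degree (reg_graph R) a"
proof -
  interpret ring_hom_ring R S \<phi>
    using assms by (intro ring_hom_ringI2) (auto simp: ring_iso_def)
  have bij: "bij_betw \<phi> (carrier R) (carrier S)"
    using \<phi> by (rule ring_iso_memE(5))
  then have eq: "\<phi> x = \<phi> y \<longleftrightarrow> x = y" if "x \<in> carrier R" "y \<in> carrier R" for x y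
    using that by (auto simp: bij_betw_def inj_on_def)
  have zero: "\<phi> x = \<zero>\<^bsub>S\<^esub> \<longleftrightarrow> x = \<zero>\<^bsub>R\<^esub>" if "x \<in> carrier R" for x
    using eq[of x "\<zero>\<^bsub>R\<^esub>"] that by simp
  have inner: "\<phi> x \<otimes>\<^bsub>S\<^esub> \<phi> y \<otimes>\<^bsub>S\<^esub> \<phi> x = \<phi> x \<longleftrightarrow> x \<otimes>\<^bsub>R\<^esub> y \<otimes>\<^bsub>R\<^esub> x = x"
    if "x \<in> carrier R" "y \<in> carrier R" for x y
    using eq[of "x \<otimes>\<^bsub>R\<^esub> y \<otimes>\<^bsub>R\<^esub> x" x] that by simp
  have vert: "\<phi> x \<in> vertices (reg_graph S) \<longleftrightarrow> x \<in> vertices (reg_graph R)" if "x \<in> carrier R" for x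
    using that zero by (auto simp: reg_graph_def)
  have sub: "vertices (reg_graph R) \<subseteq> carrier R" "vertices (reg_graph S) \<subseteq> carrier S"
    by (auto simp: reg_graph_def)
  have a': "a \<in> vertices (reg_graph R)"
    using a by (simp add: reg_graph_def)
  have adj: "adjacent (reg_graph S) (\<phi> a) (\<phi> x) \<longleftrightarrow> adjacent (reg_graph R) a x"
    if "x \<in> vertices (reg_graph R)" for x
    using that a' sub by (subst (1 2) adjacent_reg_graph_iff) (auto simp: vert eq inner subset_iff)
  have "\<phi> ` {w \<in> vertices (reg_graph R). adjacent (reg_graph R) a w} =
      {w \<in> vertices (reg_graph S). adjacent (reg_graph S) (\<phi> a) w}" (is "_ ` ?N = ?M")
  proof
    show "\<phi> ` ?N \<subseteq> ?M"
      using adj sub vert by blast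
    show "?M \<subseteq> \<phi> ` ?N"
    proof
      fix y assume y: "y \<in> ?M"
      then obtain x where "x \<in> carrier R" "y = \<phi> x"
        using bij sub by (auto simp: bij_betw_def) blast
      with y show "y \<in> \<phi> ` ?N"
        using vert adj by auto
    qed
  qed
  moreover have "inj_on \<phi> ?N"
    using bij sub by (auto simp: bij_betw_def intro: inj_on_subset)
  ultimately show ?thesis
    unfolding vertex_degree_def by (metis card_image)
qed

section \<open>Counting neighbours\<close>

lemma vertex_degree_reg_graph_eq:
  assumes "ring R" and "finite (carrier R)" and a: "a \<in> carrier R - {\<zero>\<^bsub>R\<^esub>}"
  defines "A \<equiv> {b \<in> carrier R. a \<otimes>\<^bsub>R\<^esub> b \<otimes>\<^bsub>R\<^esub> a = a}"
    and "B \<equiv> {b \<in> carrier R. b \<otimes>\<^bsub>R\<^esub> a \<otimes>\<^bsub>R\<^esub> b = b}"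
  shows "int (vertex_degree (reg_graph R) a) =
    int (card A) + int (card B) - int (card (A \<inter> B)) - (if a \<otimes>\<^bsub>R\<^esub> a \<otimes>\<^bsub>R\<^esub> a = a then 2 else 1)"
proof -
  interpret ring R by fact
  have fin: "finite A" "finite B"
    using assms(2) by (auto simp: A_def B_def)
  \<comment> \<open>Zero is left out because it is not a vertex, \<open>a\<close> because the graph
    has no loops.\<close>
  have "{w \<in> vertices (reg_graph R). adjacent (reg_graph R) a w} = A \<union> B - {\<zero>\<^bsub>R\<^esub>, a}"
    using a by (auto simp: A_def B_def adjacent_def reg_graph_def doubleton_eq_iff)
  then have "vertex_degree (reg_graph R) a = card (A \<union> B - {\<zero>\<^bsub>R\<^esub>, a})"
    by (simp add: vertex_degree_def)
  \<comment> \<open>Taking \<open>a\<close> as the partner of itself, both relations become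
    \<open>aaa = a\<close>; if this fails, \<open>a\<close> is not in the union and removing it
    changes nothing.\<close>
  also have "A \<union> B - {\<zero>\<^bsub>R\<^esub>, a} =
      A \<union> B - (if a \<otimes>\<^bsub>R\<^esub> a \<otimes>\<^bsub>R\<^esub> a = a then {\<zero>\<^bsub>R\<^esub>, a} else {\<zero>\<^bsub>R\<^esub>})" (is "_ = _ - ?Z")
    by (auto simp: A_def B_def)
  also have "int (card (A \<union> B - ?Z)) = int (card (A \<union> B)) - int (card ?Z)"
  proof -
    \<comment> \<open>Zero lies in \<open>B\<close> because \<open>0a0 = 0\<close>.\<close>
    have "?Z \<subseteq> A \<union> B"
      using a by (auto simp: A_def B_def)
    \<comment> \<open>This bound keeps the subtraction on \<open>nat\<close> from truncating, so
      that it commutes with \<open>int\<close>.\<close>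
    moreover from this have "card ?Z \<le> card (A \<union> B)"
      using fin by (intro card_mono) auto
    ultimately show ?thesis
      by (subst card_Diff_subset) (auto simp: of_nat_diff)
  qed
  also have "int (card ?Z) = (if a \<otimes>\<^bsub>R\<^esub> a \<otimes>\<^bsub>R\<^esub> a = a then 2 else 1)"
    using a by auto
  also have "int (card (A \<union> B)) = int (card A) + int (card B) - int (card (A \<inter> B))"
    using card_Un_Int[OF fin] by simp
  finally show ?thesis .
qed

lemma prod_if_one: "finite A \<Longrightarrow> (\<Prod>i\<in>A. if P i then f i else 1) = (\<Prod>i\<in>{i \<in> A. P i}. f i)"
  by (simp add: prod.inter_filter)

text \<open>Inclusion-exclusion for the boxes with sides \<open>A i\<close> and \<open>B i\<close>,
  which meet in one point: that point and the removed vertices account for the 3 or 2. The formula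
  includes \<open>I = {}\<close>, with empty product 1.\<close>

lemma vertex_degree_reg_graph_RDirProd_list:
  assumes F: "\<And>i. i < length F \<Longrightarrow> field (F ! i)"
    and fin: "finite (carrier (RDirProd_list F))"
    and x: "x \<in> carrier (RDirProd_list F)" "x \<noteq> \<zero>\<^bsub>RDirProd_list F\<^esub>"
  defines "I \<equiv> {i. i < length F \<and> x ! i = \<zero>\<^bsub>F ! i\<^esub>}"
  shows "int (vertex_degree (reg_graph (RDirProd_list F)) x) =
    2 ^ (length F - card I) + (\<Prod>i\<in>I. int (card (carrier (F ! i)))) -
    (if \<forall>i<length F. x ! i \<noteq> \<zero>\<^bsub>F ! i\<^esub> \<longrightarrow> inv\<^bsub>F ! i\<^esub> (x ! i) = x ! i then 3 else 2)"
proof -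
  let ?P = "RDirProd_list F" and ?n = "length F"
  have ringF: "ring (F ! i)" if "i < ?n" for i
    using F[OF that] by (simp add: field_def domain_def cring_def)
  have xi: "x ! i \<in> carrier (F ! i)" if "i < ?n" for i
    using RDirProd_list_carrier_mem(2)[OF x(1) that] .
  note inner = RDirProd_list_inner_inverse_iff[OF ringF]
  define A where "A i = {y \<in> carrier (F ! i). x ! i \<otimes>\<^bsub>F ! i\<^esub> y \<otimes>\<^bsub>F ! i\<^esub> x ! i = x ! i}" for i
  define B where "B i = {y \<in> carrier (F ! i). y \<otimes>\<^bsub>F ! i\<^esub> x ! i \<otimes>\<^bsub>F ! i\<^esub> y = y}" for i
  have A: "A i = (if i \<in> I then carrier (F ! i) else {inv\<^bsub>F ! i\<^esub> (x ! i)})" if "i < ?n" for i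
    using field.inner_inverses_eq[OF F xi] that by (auto simp: A_def I_def)
  have B: "B i = (if i \<in> I then {\<zero>\<^bsub>F ! i\<^esub>} else {\<zero>\<^bsub>F ! i\<^esub>, inv\<^bsub>F ! i\<^esub> (x ! i)})" if "i < ?n" for i
    using field.outer_inverses_eq[OF F xi] that by (auto simp: B_def I_def)
  \<comment> \<open>Ensures that \<open>B i\<close> has exactly two elements for \<open>i\<close>
    outside \<open>I\<close>.\<close>
  have inv0: "inv\<^bsub>F ! i\<^esub> (x ! i) \<noteq> \<zero>\<^bsub>F ! i\<^esub>" if "i < ?n" "i \<notin> I" for i
    using field.inv_nonzero(2)[OF F xi] that by (auto simp: I_def)
  have zero: "\<zero>\<^bsub>F ! i\<^esub> \<in> carrier (F ! i)" if "i < ?n" for i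
    using ringF[OF that] by (rule ring.ring_simprules(2))
  have boxA: "{y \<in> carrier ?P. x \<otimes>\<^bsub>?P\<^esub> y \<otimes>\<^bsub>?P\<^esub> x = x} = list_box ?n A"
    using x(1) by (auto simp: inner carrier_RDirProd_list list_box_def A_def)
  have boxB: "{y \<in> carrier ?P. y \<otimes>\<^bsub>?P\<^esub> x \<otimes>\<^bsub>?P\<^esub> y = y} = list_box ?n B"
    using x(1) by (auto simp: inner carrier_RDirProd_list list_box_def B_def)
  have I: "{i \<in> {..<?n}. i \<in> I} = I" "I \<subseteq> {..<?n}"
    by (auto simp: I_def)
  have "card (list_box ?n A) = (\<Prod>i<?n. if i \<in> I then card (carrier (F ! i)) else 1)"
    unfolding card_list_box by (intro prod.cong) (auto simp: A)
  also have "\<dots> = (\<Prod>i\<in>I. card (carrier (F ! i)))"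
    by (simp only: prod_if_one[OF finite_lessThan] I)
  finally have cardA: "card (list_box ?n A) = (\<Prod>i\<in>I. card (carrier (F ! i)))" .
  have "card (list_box ?n B) = (\<Prod>i<?n. if i \<notin> I then 2 else 1)"
    unfolding card_list_box using inv0 by (intro prod.cong) (force simp: B card_insert_if)+
  also have "\<dots> = 2 ^ card ({..<?n} - I)"
    by (simp add: prod_if_one set_diff_eq)
  also have "card ({..<?n} - I) = ?n - card I"
    using I(2) by (simp add: card_Diff_subset finite_subset)
  finally have cardB: "card (list_box ?n B) = 2 ^ (?n - card I)" .
  \<comment> \<open>Each side of the intersection is a singleton: zero for \<open>i\<close> in
    \<open>I\<close>, the inverse of \<open>x ! i\<close> otherwise.\<close>
  have "card (list_box ?n A \<inter> list_box ?n B) = (\<Prod>i<?n. 1)"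
    unfolding list_box_Int card_list_box using zero
    by (intro prod.cong) (auto simp: A B)
  then have cardAB: "card (list_box ?n A \<inter> list_box ?n B) = 1"
    by simp
  have self: "x \<otimes>\<^bsub>?P\<^esub> x \<otimes>\<^bsub>?P\<^esub> x = x \<longleftrightarrow>
      (\<forall>i<?n. x ! i \<noteq> \<zero>\<^bsub>F ! i\<^esub> \<longrightarrow> inv\<^bsub>F ! i\<^esub> (x ! i) = x ! i)"
    using x(1) xi field.inner_inverse_iff[OF F] by (auto simp: inner)
  show ?thesis
    using vertex_degree_reg_graph_eq[OF RDirProd_list_is_ring[OF ringF] fin, of x] x
    unfolding boxA boxB cardA cardB cardAB self by auto
qed

theorem theorem4:
  fixes R :: "('a, 'm) ring_scheme"
    and F :: "('b, 'n) ring_scheme list"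
    and \<phi> :: "'a \<Rightarrow> 'b list"
    and a :: 'a
    and I :: "nat set"
    and n k :: nat
  assumes "cring R"
    and "finite (carrier R)"
    and "von_neumann_regular_ring R"
    and "length F = n"
    and "\<And>i. i < n \<Longrightarrow> field (F ! i)"
    and "\<phi> \<in> ring_iso R (RDirProd_list F)"
    and "a \<in> vertices (reg_graph R)"
    and "I = {i. i < n \<and> \<phi> a ! i = \<zero>\<^bsub>F ! i\<^esub>}"
    and "k = card I"
  shows "(k > 0 \<longrightarrow>
      int (vertex_degree (reg_graph R) a) =
        (if \<forall>i<n. \<phi> a ! i \<noteq> \<zero>\<^bsub>F ! i\<^esub> \<longrightarrow> inv\<^bsub>F ! i\<^esub> (\<phi> a ! i) = \<phi> a ! i
         then 2 ^ (n - k) - 3 + (\<Prod>i\<in>I. int (card (carrier (F ! i))))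
         else 2 ^ (n - k) - 2 + (\<Prod>i\<in>I. int (card (carrier (F ! i))))))
    \<and> (k = 0 \<longrightarrow>
      int (vertex_degree (reg_graph R) a) =
        (if \<forall>i<n. inv\<^bsub>F ! i\<^esub> (\<phi> a ! i) = \<phi> a ! i
         then 2 ^ n - 2
         else 2 ^ n - 1))"
proof -
  have RF: "ring R" "ring (RDirProd_list F)"
    using assms(1,4,5) by (auto simp: field_def domain_def cring_def intro!: RDirProd_list_is_ring)
  have a: "a \<in> carrier R - {\<zero>\<^bsub>R\<^esub>}"
    using assms(7) by (simp add: reg_graph_def)
  have "bij_betw \<phi> (carrier R) (carrier (RDirProd_list F))"
    using assms(6) by (rule ring_iso_memE(5))
  then have "finite (carrier (RDirProd_list F))"
    using assms(2) bij_betw_finite by blast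
  then have "int (vertex_degree (reg_graph (RDirProd_list F)) (\<phi> a)) =
      2 ^ (n - k) + (\<Prod>i\<in>I. int (card (carrier (F ! i)))) -
      (if \<forall>i<n. \<phi> a ! i \<noteq> \<zero>\<^bsub>F ! i\<^esub> \<longrightarrow> inv\<^bsub>F ! i\<^esub> (\<phi> a ! i) = \<phi> a ! i then 3 else 2)"
    unfolding assms(9,8) assms(4)[symmetric]
    using assms(4,5) ring_iso_nonzero[OF RF assms(6) a]
    by (intro vertex_degree_reg_graph_RDirProd_list) auto
  then have deg: "int (vertex_degree (reg_graph R) a) =
      2 ^ (n - k) + (\<Prod>i\<in>I. int (card (carrier (F ! i)))) -
      (if \<forall>i<n. \<phi> a ! i \<noteq> \<zero>\<^bsub>F ! i\<^esub> \<longrightarrow> inv\<^bsub>F ! i\<^esub> (\<phi> a ! i) = \<phi> a ! i then 3 else 2)"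
    unfolding vertex_degree_reg_graph_iso[OF RF assms(6) a] .
  show ?thesis
  proof (cases "k = 0")
    case True
    \<comment> \<open>\<open>I\<close> is bounded by \<open>n\<close>, hence finite, so cardinality
      0 means empty. The product over \<open>I\<close> is then 1, which turns the constants 3 and 2
      into 2 and 1, and the guard for nonzero coordinates becomes vacuous.\<close>
    then have "I = {}"
      using assms(8,9) by simp
    moreover from this have "\<phi> a ! i \<noteq> \<zero>\<^bsub>F ! i\<^esub>" if "i < n" for i
      using that assms(8) by blast
    ultimately show ?thesis
      using True deg by simp
  next
    case False
    then show ?thesis
      unfolding deg by auto
  qed
qed

end
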